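(* Let $\{(x^k,\bar x^k,\lambda^k)\}_{k\ge 1}$ be a sequence generated by the accelerated linearized augmented Lagrangian method (described in the context) for the problem $\min_x f(x)+g(x)$ subject to $Ax=b$, with parameters set, for all $k\ge1$, to $$\alpha_k=1,\quad \beta_k=\beta>0,\quad \gamma_k=\gamma\in(0,2\beta),\quad P^k=P\succ L_f I .$$ Then $\bar x^k=x^k$ for all $k$, and $\{(x^k,\lambda^k)\}_{k\ge1}$ is bounded and converges to a point $(x^\infty,\lambda^\infty)$ that satisfies the KKT conditions $0\in\partial F(x^\infty)-A^\top\lambda^\infty$ and $Ax^\infty-b=0$. In addition, if $(x^*,\lambda^* )$ is any point satisfying these KKT conditions, then for every $t\ge1$, with $\tilde x^{t+1}=\frac{1}{t}\sum_{k=1}^t x^{k+1}$, $$|F(\tilde x^{t+1})-F(x^* )|\le\frac1t\left(\frac12\|x^1-x^*\|_P^2+\frac{2\|\lambda^*\|^2}{\gamma}\right),$$ and, if $\lambda^*\neq0$, $$\|A\tilde x^{t+1}-b\|\le\frac{1}{t\|\lambda^*\|}\left(\frac12\|x^1-x^*\|_P^2+\frac{2\|\lambda^*\|^2}{\gamma}\right).$$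
   Context: Setting: $x\in\mathbb{R}^n$, $A\in\mathbb{R}^{m\times n}$, $b\in\mathbb{R}^m$, norms are Euclidean. $F=f+g$, where $f:\mathbb{R}^n\to\mathbb{R}$ is convex and differentiable and $g:\mathbb{R}^n\to\mathbb{R}\cup\{+\infty\}$ is proper closed convex, possibly nondifferentiable. For a vector $v$ and symmetric matrix $W$, $\|v\|_W^2=v^\top Wv$; $P\succ L_fI$ means that $P$ is symmetric and $P-L_fI$ is positive definite. Standing assumptions: (1) there exists a point $(x^*,\lambda^* )$ satisfying the KKT conditions $0\in\partial F(x^* )-A^\top\lambda^*$, $Ax^*=b$; (2) $\nabla f$ is Lipschitz continuous with constant $L_f$: $\|\nabla f(x)-\nabla f(\tilde x)\|\le L_f\|x-\tilde x\|$ for all $x,\tilde x$. Accelerated linearized augmented Lagrangian method: choose $\bar x^1=x^1\in\mathbb{R}^n$ and set $\lambda^1=0$. For $k=1,2,\ldots$, with parameters $\alpha_k,\beta_k,\gamma_k$ and $P^k$ (a symmetric matrix), perform $$\hat x^k=(1-\alpha_k)\bar x^k+\alpha_k x^k,$$ $$x^{k+1}\in\operatorname{argmin}_x\ \langle\nabla f(\hat x^k)-A^\top\lambda^k,x\rangle+g(x)+\frac{\beta_k}{2}\|Ax-b\|^2+\frac12\|x-x^k\|_{P^k}^2,$$ $$\bar x^{k+1}=(1-\alpha_k)\bar x^k+\alpha_k x^{k+1},$$ $$\lambda^{k+1}=\lambda^k-\gamma_k(Ax^{k+1}-b).$$ *)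

theory Defs
  imports "HOL-Analysis.Analysis"
begin

definition gradient :: "('a::real_inner \<Rightarrow> real) \<Rightarrow> 'a \<Rightarrow> 'a" where
  "gradient f x = (THE D. GDERIV f x :> D)"

lemma GDERIV_gradient:
  fixes f :: "'a::euclidean_space \<Rightarrow> real"
  assumes "f differentiable (at x)"
  shows "GDERIV f x :> gradient f x"
proof -
  obtain f' where f': "(f has_derivative f') (at x)"
    using assms by (auto simp: differentiable_def)
  have "f' = (\<lambda>h. h \<bullet> adjoint f' 1)"
    using adjoint_works[OF has_derivative_linear[OF f'], of _ 1] by (auto simp: fun_eq_iff)
  with f' have ex: "GDERIV f x :> adjoint f' 1"
    by (simp add: gderiv_def)
  moreover have "D = E" if "GDERIV f x :> D" "GDERIV f x :> E" for D E
    using has_derivative_unique[OF that[unfolded gderiv_def]]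
    by (metis inner_commute vector_eq_rdot)
  ultimately show ?thesis
    unfolding gradient_def by (metis theI)
qed


text \<open>
  Extended-real-valued functions. The library's \<open>epigraph\<close> only covers real-valued functions;
  here the second component of the epigraph is still a finite real, so that closedness and
  convexity of the epigraph are the usual notions of a closed (lower semicontinuous) and of a
  convex function into $(-\infty, +\infty]$.
\<close>

definition ereal_epigraph :: "('a \<Rightarrow> ereal) \<Rightarrow> ('a \<times> real) set" where
  "ereal_epigraph g = {(x, r). g x \<le> ereal r}"

definition proper_fun :: "('a \<Rightarrow> ereal) \<Rightarrow> bool" where
  "proper_fun g \<longleftrightarrow> (\<forall>x. g x \<noteq> -\<infinity>) \<and> (\<exists>x. g x \<noteq> \<infinity>)"

definition closed_fun :: "('a::topological_space \<Rightarrow> ereal) \<Rightarrow> bool" where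
  "closed_fun g \<longleftrightarrow> closed (ereal_epigraph g)"

definition convex_fun :: "('a::real_vector \<Rightarrow> ereal) \<Rightarrow> bool" where
  "convex_fun g \<longleftrightarrow> convex (ereal_epigraph g)"

text \<open>The subdifferential is empty at points where the function is not finite.\<close>

definition subdifferential :: "('a::real_inner \<Rightarrow> ereal) \<Rightarrow> 'a \<Rightarrow> 'a set" where
  "subdifferential F x =
     {v. \<bar>F x\<bar> \<noteq> \<infinity> \<and> (\<forall>y. F y \<ge> F x + ereal (v \<bullet> (y - x)))}"

definition composite :: "('a \<Rightarrow> real) \<Rightarrow> ('a \<Rightarrow> ereal) \<Rightarrow> 'a \<Rightarrow> ereal" where
  "composite f g x = ereal (f x) + g x"

definition KKT ::
  "(real^'n \<Rightarrow> ereal) \<Rightarrow> real^'n^'m \<Rightarrow> real^'m \<Rightarrow> real^'n \<Rightarrow> real^'m \<Rightarrow> bool" where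
  "KKT F A b x l \<longleftrightarrow>
     0 \<in> (\<lambda>v. v - transpose A *v l) ` subdifferential F x \<and> A *v x - b = 0"

definition sq_norm_wrt :: "real^'n^'n \<Rightarrow> real^'n \<Rightarrow> real" where
  "sq_norm_wrt W v = v \<bullet> (W *v v)"

definition symmetric_matrix :: "real^'n^'n \<Rightarrow> bool" where
  "symmetric_matrix W \<longleftrightarrow> transpose W = W"

definition positive_definite :: "real^'n^'n \<Rightarrow> bool" where
  "positive_definite W \<longleftrightarrow> symmetric_matrix W \<and> (\<forall>v. v \<noteq> 0 \<longrightarrow> v \<bullet> (W *v v) > 0)"

text \<open>
  \<open>accelerated_LALM f g A b \<alpha> \<beta> \<gamma> P x xb l\<close>: the sequences \<open>x\<close>, \<open>xb\<close> (written $\bar x$ on paper) and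
  \<open>l\<close> (the multipliers) are generated by the accelerated linearized augmented Lagrangian method.
  Sequences are indexed from 1; their values at 0 are irrelevant. The \<open>x\<close>-update is a
  relation, as the method may pick any minimizer.
\<close>

definition accelerated_LALM ::
  "(real^'n \<Rightarrow> real) \<Rightarrow> (real^'n \<Rightarrow> ereal) \<Rightarrow> real^'n^'m \<Rightarrow> real^'m \<Rightarrow>
   (nat \<Rightarrow> real) \<Rightarrow> (nat \<Rightarrow> real) \<Rightarrow> (nat \<Rightarrow> real) \<Rightarrow> (nat \<Rightarrow> real^'n^'n) \<Rightarrow>
   (nat \<Rightarrow> real^'n) \<Rightarrow> (nat \<Rightarrow> real^'n) \<Rightarrow> (nat \<Rightarrow> real^'m) \<Rightarrow> bool" where
  "accelerated_LALM f g A b \<alpha> \<beta> \<gamma> P x xb l \<longleftrightarrow>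
     xb 1 = x 1 \<and> l 1 = 0 \<and>
     (\<forall>k\<ge>1.
        symmetric_matrix (P k) \<and>
        (let xh = (1 - \<alpha> k) *\<^sub>R xb k + \<alpha> k *\<^sub>R x k in
           is_arg_min
             (\<lambda>y. ereal ((gradient f xh - transpose A *v l k) \<bullet> y) + g y
                  + ereal (\<beta> k / 2 * (norm (A *v y - b))\<^sup>2)
                  + ereal (1 / 2 * sq_norm_wrt (P k) (y - x k)))
             (\<lambda>_. True) (x (k + 1))) \<and>
        xb (k + 1) = (1 - \<alpha> k) *\<^sub>R xb k + \<alpha> k *\<^sub>R x (k + 1) \<and>
        l (k + 1) = l k - \<gamma> k *\<^sub>R (A *v x (k + 1) - b))"

end

theory Submission
  imports Defs
begin

text \<open>
  With \<open>\<alpha>\<^sub>k = 1\<close> the optimality condition of the subproblem, convexity of \<open>f\<close> and the descent lemma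
  combine into one inequality for \<open>F\<close> at \<open>x\<^bsup>k+1\<^esup>\<close> against an arbitrary point (\<open>step\<close> below).
  Tested at a feasible point \<open>y\<close>, and for any multiplier \<open>\<mu>\<close>, it makes
  \<open>F(x\<^bsup>k+1\<^esup>) - F(y) - \<langle>\<mu>, Ax\<^bsup>k+1\<^esup> - b\<rangle>\<close> at most the decrease of the potential
  \<open>\<parallel>x\<^bsup>k\<^esup> - y\<parallel>\<^sup>2\<^sub>P / 2 + \<parallel>\<lambda>\<^bsup>k\<^esup> - \<mu>\<parallel>\<^sup>2 / (2\<gamma>)\<close>.
  At a KKT point the potential is therefore nonincreasing and successive differences vanish, so a
  cluster point exists; letting \<open>k \<rightarrow> \<infinity>\<close> in \<open>step\<close> shows that it is a KKT point, and the potential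
  centred there tends to zero. Telescoping with \<open>\<parallel>\<mu>\<parallel> = 2\<parallel>\<lambda>\<^sup>*\<parallel>\<close> opposite to the averaged residual
  gives the rates.
\<close>

section \<open>First-order bounds for the smooth convex part\<close>

text \<open>Restricting \<open>f\<close> to the line through \<open>x\<close> and \<open>y\<close>
  gives a convex function of one real variable, which lies above its tangent at 0; the chain rule
  identifies the slope.\<close>

lemma convex_above_gradient:
  fixes f :: "'a::real_inner \<Rightarrow> real"
  assumes "convex_on UNIV f" and D: "GDERIV f x :> D"
  shows "f x + D \<bullet> (y - x) \<le> f y"
proof -
  define \<phi> where "\<phi> t = f (x + t *\<^sub>R (y - x))" for t :: real
  have "convex_on UNIV \<phi>"
  proof (rule convex_onI)
    fix t u v :: real assume "0 < t" "t < 1"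
    have "x + ((1 - t) * u + t * v) *\<^sub>R (y - x)
        = (1 - t) *\<^sub>R (x + u *\<^sub>R (y - x)) + t *\<^sub>R (x + v *\<^sub>R (y - x))"
      by (simp add: algebra_simps)
    then show "\<phi> ((1 - t) *\<^sub>R u + t *\<^sub>R v) \<le> (1 - t) * \<phi> u + t * \<phi> v"
      unfolding \<phi>_def
      using convex_onD[OF assms(1), of t "x + u *\<^sub>R (y - x)" "x + v *\<^sub>R (y - x)"] \<open>0 < t\<close> \<open>t < 1\<close>
      by simp
  qed simp
  moreover have "(\<phi> has_real_derivative D \<bullet> (y - x)) (at 0)"
  proof -
    have "((\<lambda>t::real. x + t *\<^sub>R (y - x)) has_derivative (\<lambda>t. t *\<^sub>R (y - x))) (at 0)"
      by (auto intro!: derivative_eq_intros)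
    moreover have "(f has_derivative (\<lambda>h. h \<bullet> D)) (at (x + 0 *\<^sub>R (y - x)))"
      using D by (simp add: gderiv_def)
    ultimately have "(\<phi> has_derivative (\<lambda>t. (t *\<^sub>R (y - x)) \<bullet> D)) (at 0)"
      unfolding \<phi>_def by (rule has_derivative_compose)
    then show ?thesis
      by (simp add: has_field_derivative_def inner_commute mult_commute_abs)
  qed
  ultimately have "\<phi> 1 - \<phi> 0 \<ge> D \<bullet> (y - x) * (1 - 0)"
    by (intro convex_on_imp_above_tangent) (auto simp: has_field_derivative_at_within)
  then show ?thesis
    by (simp add: \<phi>_def)
qed

text \<open>The descent lemma. Along the segment from \<open>x\<close> to \<open>y\<close>,
  \<open>f\<close> minus its linear and quadratic parts has nonpositive derivative, by
  Cauchy-Schwarz and the Lipschitz bound; comparing the endpoints avoids an integral.\<close>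

lemma lipschitz_gradient_upper_bound:
  fixes f :: "'a::real_inner \<Rightarrow> real"
  assumes D: "\<And>z. GDERIV f z :> f' z" and lip: "L-lipschitz_on UNIV f'"
  shows "f y \<le> f x + f' x \<bullet> (y - x) + L / 2 * (norm (y - x))\<^sup>2"
proof -
  define d where "d = y - x"
  define \<phi> where "\<phi> t = f (x + t *\<^sub>R d) - t * (f' x \<bullet> d) - L / 2 * t\<^sup>2 * (norm d)\<^sup>2" for t :: real
  have deriv: "(\<phi> has_real_derivative
      f' (x + t *\<^sub>R d) \<bullet> d - f' x \<bullet> d - L * t * (norm d)\<^sup>2) (at t)" for t
  proof -
    have "((\<lambda>t::real. x + t *\<^sub>R d) has_derivative (\<lambda>s. s *\<^sub>R d)) (at t)"
      by (auto intro!: derivative_eq_intros)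
    then have "((\<lambda>t. f (x + t *\<^sub>R d)) has_derivative (\<lambda>s. (s *\<^sub>R d) \<bullet> f' (x + t *\<^sub>R d))) (at t)"
      by (rule has_derivative_compose) (use D in \<open>simp add: gderiv_def\<close>)
    then have "((\<lambda>t. f (x + t *\<^sub>R d)) has_real_derivative f' (x + t *\<^sub>R d) \<bullet> d) (at t)"
      by (simp add: has_field_derivative_def inner_commute mult_commute_abs)
    then show ?thesis
      unfolding \<phi>_def by (auto intro!: derivative_eq_intros)
  qed
  have nonpos: "f' (x + t *\<^sub>R d) \<bullet> d - f' x \<bullet> d - L * t * (norm d)\<^sup>2 \<le> 0" if "0 \<le> t" for t
  proof -
    have "f' (x + t *\<^sub>R d) \<bullet> d - f' x \<bullet> d \<le> norm (f' (x + t *\<^sub>R d) - f' x) * norm d"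
      by (metis inner_diff_left norm_cauchy_schwarz)
    also have "\<dots> \<le> (L * (t * norm d)) * norm d"
      using lipschitz_onD[OF lip, of "x + t *\<^sub>R d" x] that
      by (intro mult_right_mono) (auto simp: dist_norm)
    finally show ?thesis
      by (simp add: power2_eq_square algebra_simps)
  qed
  have "\<phi> 1 \<le> \<phi> 0"
    by (rule DERIV_nonpos_imp_nonincreasing[of 0 1 \<phi>]) (simp, blast intro: deriv nonpos)
  then show ?thesis
    by (simp add: \<phi>_def d_def)
qed

section \<open>Matrices and weighted quadratic forms\<close>

lemma adjoint_matrix_inner: "(transpose A *v u) \<bullet> v = u \<bullet> (A *v (v :: real^'n))"
  for A :: "real^'n^'m"
  by (simp add: dot_lmul_matrix transpose_matrix_vector)

lemma symmetric_matrix_inner: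
  "symmetric_matrix W \<Longrightarrow> u \<bullet> (W *v v) = v \<bullet> (W *v u)"
  by (metis adjoint_matrix_inner inner_commute symmetric_matrix_def)

lemma sq_norm_wrt_add:
  assumes "symmetric_matrix W"
  shows "sq_norm_wrt W (u + v) = sq_norm_wrt W u + 2 * ((W *v u) \<bullet> v) + sq_norm_wrt W v"
  using symmetric_matrix_inner[OF assms, of u v]
  by (simp add: sq_norm_wrt_def matrix_vector_right_distrib inner_add inner_commute)

lemma sq_norm_wrt_scaleR: "sq_norm_wrt W (t *\<^sub>R v) = t\<^sup>2 * sq_norm_wrt W v"
  by (simp add: sq_norm_wrt_def matrix_vector_mult_scaleR power2_eq_square)

text \<open>The quadratic form attains a positive minimum on the compact unit sphere, and
  homogeneity of degree 2 carries it to all vectors.\<close>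

lemma positive_definite_coercive:
  fixes W :: "real^'n^'n"
  assumes "positive_definite W"
  obtains m where "0 < m" "\<And>v. m * (norm v)\<^sup>2 \<le> sq_norm_wrt W v"
proof -
  have cont: "continuous_on (sphere 0 1) (sq_norm_wrt W)"
    unfolding sq_norm_wrt_def[abs_def]
    by (intro continuous_intros matrix_vector_mult_linear_continuous_on)
  obtain u where u: "u \<in> sphere 0 1" "\<And>v. v \<in> sphere 0 1 \<Longrightarrow> sq_norm_wrt W u \<le> sq_norm_wrt W v"
    using continuous_attains_inf[OF _ _ cont] by auto
  have "u \<noteq> 0"
    using u(1) by auto
  then have "0 < sq_norm_wrt W u"
    using assms by (simp add: positive_definite_def sq_norm_wrt_def)
  moreover have "sq_norm_wrt W u * (norm v)\<^sup>2 \<le> sq_norm_wrt W v" for v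
  proof (cases "v = 0")
    case False
    have "sq_norm_wrt W v = (norm v)\<^sup>2 * sq_norm_wrt W ((1 / norm v) *\<^sub>R v)"
      using False by (simp add: sq_norm_wrt_scaleR power_divide)
    moreover have "sq_norm_wrt W u \<le> sq_norm_wrt W ((1 / norm v) *\<^sub>R v)"
      using False by (intro u(2)) simp
    ultimately show ?thesis
      using mult_left_mono[of _ _ "(norm v)\<^sup>2"] by (simp add: mult.commute[of "sq_norm_wrt W u"])
  qed (simp add: sq_norm_wrt_def)
  ultimately show thesis
    using that by blast
qed

section \<open>The optimality condition of the subproblem\<close>

text \<open>Divide by \<open>t\<close> and let \<open>t\<close> decrease to 0. This extracts a
  first-order condition from minimality along a segment.\<close>

lemma nonneg_linear_coefficient:
  fixes a K :: real
  assumes "\<And>t. 0 < t \<Longrightarrow> t < 1 \<Longrightarrow> 0 \<le> t * a + t\<^sup>2 * K"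
  shows "0 \<le> a"
proof (rule tendsto_lowerbound)
  have "((\<lambda>t. a + t * K) \<longlongrightarrow> a + 0 * K) (at_right 0)"
    by (intro tendsto_intros)
  then show "((\<lambda>t. a + t * K) \<longlongrightarrow> a) (at_right 0)"
    by simp
  have "0 \<le> a + t * K" if "t \<in> {0<..<1}" for t
  proof -
    have "0 \<le> t * (a + t * K)"
      using assms[of t] that by (simp add: algebra_simps power2_eq_square)
    with that show ?thesis
      by (simp add: zero_le_mult_iff)
  qed
  then show "\<forall>\<^sub>F t in at_right 0. 0 \<le> a + t * K"
    using eventually_at_right_less[of "0::real"] eventually_at_right[of 0 "1::real"]
    by (intro eventually_mono[OF eventually_at_right_real[of 0 1]]) auto
qed simp

lemma convex_fun_le:
  assumes "convex_fun g" "g y \<le> ereal r" "g z \<le> ereal s" "0 \<le> t" "t \<le> 1"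
  shows "g ((1 - t) *\<^sub>R y + t *\<^sub>R z) \<le> ereal ((1 - t) * r + t * s)"
  using convexD[OF assms(1)[unfolded convex_fun_def], of "(y, r)" "(z, s)" "1 - t" t] assms(2-)
  by (simp add: ereal_epigraph_def)

lemma prox_finite:
  assumes "proper_fun g"
    and "is_arg_min (\<lambda>y. ereal (p y) + g y + ereal (q y) + ereal (r y)) (\<lambda>_. True) z"
  obtains gz where "g z = ereal gz"
proof -
  obtain y gy where "g y = ereal gy"
    using assms(1) unfolding proper_fun_def by (metis ereal_cases)
  then have "g z \<noteq> \<infinity>"
    using assms(2) by (auto simp: is_arg_min_def dest!: spec[of _ y])
  moreover have "g z \<noteq> -\<infinity>"
    using assms(1) by (simp add: proper_fun_def)
  ultimately show thesis
    using that by (cases "g z") auto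
qed

text \<open>A variational form of optimality that bypasses subdifferential calculus. The minimizer
  \<open>z\<close> is compared with \<open>z + t *\<^sub>R d\<close> on the segment to
  \<open>y\<close>: convexity bounds \<open>g\<close> there by its chord, the quadratic terms expand
  exactly, and the coefficient of \<open>t\<close> must be nonnegative.\<close>

lemma prox_inequality:
  fixes g :: "real^'n \<Rightarrow> ereal" and A :: "real^'n^'m"
  assumes "proper_fun g" "convex_fun g" "symmetric_matrix P"
    and amin: "is_arg_min
      (\<lambda>y. ereal (c \<bullet> y) + g y + ereal (\<beta> / 2 * (norm (A *v y - b))\<^sup>2)
        + ereal (1 / 2 * sq_norm_wrt P (y - x0))) (\<lambda>_. True) z"
    and gz: "g z = ereal gz" and gy: "g y \<le> ereal s"
  shows "gz \<le> s + c \<bullet> (y - z) + \<beta> * ((A *v z - b) \<bullet> (A *v (y - z))) + (P *v (z - x0)) \<bullet> (y - z)"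
proof -
  define d where "d = y - z"
  have "0 \<le> t * (s - gz + c \<bullet> d + \<beta> * ((A *v z - b) \<bullet> (A *v d)) + (P *v (z - x0)) \<bullet> d)
      + t\<^sup>2 * (\<beta> / 2 * (norm (A *v d))\<^sup>2 + 1 / 2 * sq_norm_wrt P d)" if t: "0 < t" "t < 1" for t
  proof -
    define w where "w = z + t *\<^sub>R d"
    have "w = (1 - t) *\<^sub>R z + t *\<^sub>R y"
      by (simp add: w_def d_def algebra_simps)
    then have gw: "g w \<le> ereal ((1 - t) * gz + t * s)"
      using convex_fun_le[OF assms(2), of z gz y s t] gz gy t by simp
    \<comment> \<open>The chord bound excludes the value \<infinity> and properness excludes
      -\<infinity>, so the comparison of objectives takes place among reals.\<close>
    then obtain h where h: "g w = ereal h" "h \<le> (1 - t) * gz + t * s"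
      using assms(1) by (cases "g w") (auto simp: proper_fun_def)
    have "c \<bullet> z + gz + \<beta> / 2 * (norm (A *v z - b))\<^sup>2 + 1 / 2 * sq_norm_wrt P (z - x0)
        \<le> c \<bullet> w + h + \<beta> / 2 * (norm (A *v w - b))\<^sup>2 + 1 / 2 * sq_norm_wrt P (w - x0)"
      using amin h(1) gz unfolding is_arg_min_def by (auto simp: not_less dest!: spec[of _ w])
    moreover have "(norm (A *v w - b))\<^sup>2
        = (norm (A *v z - b))\<^sup>2 + 2 * t * ((A *v z - b) \<bullet> (A *v d)) + t\<^sup>2 * (norm (A *v d))\<^sup>2"
    proof -
      have "A *v w - b = (A *v z - b) + t *\<^sub>R (A *v d)"
        by (simp add: w_def matrix_vector_right_distrib matrix_vector_mult_scaleR)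
      then show ?thesis
        by (simp only: power2_norm_eq_inner)
          (simp add: inner_add inner_commute power2_eq_square)
    qed
    moreover have "sq_norm_wrt P (w - x0)
        = sq_norm_wrt P (z - x0) + 2 * t * ((P *v (z - x0)) \<bullet> d) + t\<^sup>2 * sq_norm_wrt P d"
    proof -
      have "w - x0 = (z - x0) + t *\<^sub>R d"
        by (simp add: w_def)
      then show ?thesis
        by (simp only: sq_norm_wrt_add[OF assms(3)]) (simp add: sq_norm_wrt_scaleR)
    qed
    moreover have "c \<bullet> w = c \<bullet> z + t * (c \<bullet> d)"
      by (simp add: w_def inner_add)
    ultimately show ?thesis
      using h(2) by (simp add: algebra_simps)
  qed
  from nonneg_linear_coefficient[OF this] show ?thesis
    by (simp add: d_def)
qed

section \<open>The composite objective and its KKT points\<close>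

text \<open>Subtracting \<open>f y\<close> from the height is a continuous map that pulls the
  epigraph of \<open>g\<close> back to that of the sum.\<close>

lemma closed_fun_composite:
  assumes "continuous_on UNIV f" "closed_fun g"
  shows "closed_fun (composite f g)"
proof -
  have "ereal (f y) + g y \<le> ereal r \<longleftrightarrow> g y \<le> ereal (r - f y)" for y r
    by (cases "g y") auto
  then have "ereal_epigraph (composite f g) = (\<lambda>(y, r). (y, r - f y)) -` ereal_epigraph g"
    by (auto simp: ereal_epigraph_def composite_def)
  moreover have "continuous_on UNIV (\<lambda>(y, r). (y, r - f y))"
    unfolding case_prod_beta
    by (intro continuous_intros continuous_on_compose2[OF assms(1)]) auto
  ultimately show ?thesis
    using assms(2) by (auto simp: closed_fun_def intro: closed_vimage)
qed

lemma convex_fun_composite: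
  assumes "convex_on UNIV f" "convex_fun g"
  shows "convex_fun (composite f g)"
  unfolding convex_fun_def
proof (rule convexI, clarify)
  fix y z r s and u v :: real
  assume *: "(y, r) \<in> ereal_epigraph (composite f g)" "(z, s) \<in> ereal_epigraph (composite f g)"
    and uv: "0 \<le> u" "0 \<le> v" "u + v = 1"
  have le: "ereal (f y) + g y \<le> ereal r \<longleftrightarrow> g y \<le> ereal (r - f y)" for y r
    by (cases "g y") auto
  have u: "u = 1 - v"
    using uv by simp
  have "g ((1 - v) *\<^sub>R y + v *\<^sub>R z) \<le> ereal ((1 - v) * (r - f y) + v * (s - f z))"
    using * uv by (intro convex_fun_le[OF assms(2)]) (auto simp: ereal_epigraph_def composite_def le)
  moreover have "f ((1 - v) *\<^sub>R y + v *\<^sub>R z) \<le> (1 - v) * f y + v * f z"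
    using convex_onD[OF assms(1), of v y z] uv by simp
  then have "(1 - v) * (r - f y) + v * (s - f z)
      \<le> (1 - v) * r + v * s - f ((1 - v) *\<^sub>R y + v *\<^sub>R z)"
    by (simp add: algebra_simps)
  ultimately show "u *\<^sub>R (y, r) + v *\<^sub>R (z, s) \<in> ereal_epigraph (composite f g)"
    by (auto simp: ereal_epigraph_def composite_def le u intro: order_trans)
qed

text \<open>Zero lies in the image only if \<open>transpose A *v \<mu>\<close> is a subgradient;
  moving the transpose across the inner product leaves a condition on \<open>F\<close>
  alone.\<close>

lemma KKT_iff:
  "KKT F A b y \<mu> \<longleftrightarrow> \<bar>F y\<bar> \<noteq> \<infinity> \<and> A *v y = b \<and> (\<forall>z. F y + ereal (\<mu> \<bullet> (A *v (z - y))) \<le> F z)"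
  by (auto simp: KKT_def subdifferential_def image_iff dot_lmul_matrix)

section \<open>The abstract iteration and its potential\<close>

text \<open>All that the convergence analysis retains of \<open>f\<close>, \<open>g\<close> and the
  minimization is the inequality \<open>step\<close>. Bounding \<open>F y\<close> by a real
  \<open>s\<close> keeps its right-hand side real, so that it can be read as membership in the
  closed epigraph and passed to the limit.\<close>

locale linearized_AL_iteration =
  fixes F :: "real^'n \<Rightarrow> ereal" and A :: "real^'n^'m" and b :: "real^'m"
    and P :: "real^'n^'n" and L \<beta> \<gamma> :: real
    and x :: "nat \<Rightarrow> real^'n" and l :: "nat \<Rightarrow> real^'m"
  assumes F_not_MInf: "F y \<noteq> -\<infinity>" and F_closed: "closed_fun F" and F_convex: "convex_fun F"
    and L_nonneg: "0 \<le> L" and \<gamma>_pos: "0 < \<gamma>" and \<gamma>_less: "\<gamma> < 2 * \<beta>"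
    and P_symmetric: "symmetric_matrix P" and P_definite: "positive_definite (P - L *\<^sub>R mat 1)"
    and F_finite: "1 \<le> k \<Longrightarrow> F (x (Suc k)) \<noteq> \<infinity>"
    and step: "1 \<le> k \<Longrightarrow> F y \<le> ereal s \<Longrightarrow>
      F (x (Suc k)) \<le> ereal (s + (l k - \<beta> *\<^sub>R (A *v x (Suc k) - b)) \<bullet> (A *v (x (Suc k) - y))
        - (P *v (x (Suc k) - x k)) \<bullet> (x (Suc k) - y) + L / 2 * (norm (x (Suc k) - x k))\<^sup>2)"
    and multiplier: "1 \<le> k \<Longrightarrow> l (Suc k) = l k - \<gamma> *\<^sub>R (A *v x (Suc k) - b)"
    and multiplier_1: "l 1 = 0"
begin

definition residual :: "nat \<Rightarrow> real^'m" where
  "residual k = A *v x k - b"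

text \<open>\<open>F\<close> may be infinite at the starting point \<open>x 1\<close>, where
  \<open>real_of_ereal\<close> returns a default; \<open>val\<close> is therefore used only at
  indices from 2 on.\<close>

definition val :: "nat \<Rightarrow> real" where
  "val k = real_of_ereal (F (x k))"

text \<open>A Lyapunov function, with weights that make the cross terms of both updates match the
  linear terms of \<open>step\<close>. The centre is a parameter because it varies: a given KKT
  point, the cluster point, and a feasible point with a multiplier chosen for the rates.\<close>

definition potential :: "real^'n \<Rightarrow> real^'m \<Rightarrow> nat \<Rightarrow> real" where
  "potential y \<mu> k = 1 / 2 * sq_norm_wrt P (x k - y) + (norm (l k - \<mu>))\<^sup>2 / (2 * \<gamma>)"

lemma F_val: "1 \<le> k \<Longrightarrow> F (x (Suc k)) = ereal (val (Suc k))"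
  using F_not_MInf[of "x (Suc k)"] F_finite[of k] by (cases "F (x (Suc k))") (simp_all add: val_def)

lemma sq_norm_shift: "sq_norm_wrt (P - L *\<^sub>R mat 1) v = sq_norm_wrt P v - L * (norm v)\<^sup>2"
  by (simp add: sq_norm_wrt_def matrix_vector_mult_diff_rdistrib inner_diff_right
      scaleR_matrix_vector_assoc[symmetric] power2_norm_eq_inner)

text \<open>\<open>m\<close> is a coercivity constant of \<open>P - L *\<^sub>R mat 1\<close>. The
  first bound leaves a positive margin after the smoothness error \<open>L / 2 * (norm d)^2\<close>
  is absorbed; the second follows from \<open>0 \<le> L\<close> and controls distances.\<close>

lemma coercive:
  obtains m where "0 < m" "\<And>v. m * (norm v)\<^sup>2 + L * (norm v)\<^sup>2 \<le> sq_norm_wrt P v"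
    "\<And>v. m * (norm v)\<^sup>2 \<le> sq_norm_wrt P v"
proof -
  obtain m where m: "0 < m" "\<And>v. m * (norm v)\<^sup>2 \<le> sq_norm_wrt (P - L *\<^sub>R mat 1) v"
    using positive_definite_coercive[OF P_definite] by metis
  have "m * (norm v)\<^sup>2 + L * (norm v)\<^sup>2 \<le> sq_norm_wrt P v" for v
    using m(2)[of v] by (simp add: sq_norm_shift)
  moreover have "0 \<le> L * (norm v)\<^sup>2" for v :: "real^'n"
    using L_nonneg by simp
  ultimately show thesis
    using that[OF m(1)] by (smt (verit))
qed

lemma potential_nonneg: "0 \<le> potential y \<mu> k"
proof -
  obtain m where "0 < m" "\<And>v. m * (norm v)\<^sup>2 \<le> sq_norm_wrt P v"
    using coercive by metis
  then have "0 \<le> sq_norm_wrt P (x k - y)"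
    by (metis mult_nonneg_nonneg order_trans less_imp_le zero_le_power2)
  then show ?thesis
    using \<gamma>_pos by (simp add: potential_def)
qed

text \<open>Feasibility of \<open>y\<close> turns \<open>A *v (x (Suc k) - y)\<close> into the
  residual. Expanding the multiplier update trades \<open>l k\<close> for \<open>\<mu>\<close> at
  the cost of \<open>\<gamma> / 2\<close> times the squared residual, to be paid from the penalty
  term with factor \<open>\<beta>\<close>; the three-point identity for \<open>P\<close> supplies
  the rest.\<close>

lemma potential_decrease:
  assumes k: "1 \<le> k" and "A *v y = b" "F y = ereal s"
  shows "val (Suc k) - s - \<mu> \<bullet> residual (Suc k)
      + (\<beta> - \<gamma> / 2) * (norm (residual (Suc k)))\<^sup>2
      + 1 / 2 * (sq_norm_wrt P (x (Suc k) - x k) - L * (norm (x (Suc k) - x k))\<^sup>2)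
    \<le> potential y \<mu> k - potential y \<mu> (Suc k)"
proof -
  let ?r = "residual (Suc k)" and ?d = "x (Suc k) - x k"
  have r: "A *v (x (Suc k) - y) = ?r"
    using assms by (simp add: residual_def matrix_vector_mult_diff_distrib)
  have "val (Suc k) \<le> s + (l k - \<beta> *\<^sub>R ?r) \<bullet> ?r - (P *v ?d) \<bullet> (x (Suc k) - y) + L / 2 * (norm ?d)\<^sup>2"
    using step[OF k, of y s] assms(3) r F_val[OF k] by (simp add: residual_def)
  moreover have "(l k - \<beta> *\<^sub>R ?r) \<bullet> ?r = l k \<bullet> ?r - \<beta> * (norm ?r)\<^sup>2"
    by (simp add: inner_diff_left power2_norm_eq_inner)
  moreover have "(norm (l (Suc k) - \<mu>))\<^sup>2 / (2 * \<gamma>)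
      = (norm (l k - \<mu>))\<^sup>2 / (2 * \<gamma>) - (l k \<bullet> ?r - \<mu> \<bullet> ?r) + \<gamma> / 2 * (norm ?r)\<^sup>2"
  proof -
    have "l (Suc k) - \<mu> = (l k - \<mu>) - \<gamma> *\<^sub>R ?r"
      using multiplier[OF k] by (simp add: residual_def)
    then have "(norm (l (Suc k) - \<mu>))\<^sup>2
        = (norm (l k - \<mu>))\<^sup>2 - 2 * \<gamma> * ((l k - \<mu>) \<bullet> ?r) + \<gamma>\<^sup>2 * (norm ?r)\<^sup>2"
      by (simp only: power2_norm_eq_inner)
        (simp add: inner_diff inner_commute power2_eq_square algebra_simps)
    then show ?thesis
      using \<gamma>_pos by (simp add: field_simps power2_eq_square inner_diff_left)
  qed
  moreover have "sq_norm_wrt P (x k - y)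
      = sq_norm_wrt P (x (Suc k) - y) - 2 * ((P *v ?d) \<bullet> (x (Suc k) - y)) + sq_norm_wrt P ?d"
  proof -
    have "x k - y = - ?d + (x (Suc k) - y)"
      by simp
    moreover have "sq_norm_wrt P (- ?d) = sq_norm_wrt P ?d"
      using sq_norm_wrt_scaleR[of P "-1" ?d] by simp
    moreover have "P *v (- ?d) = - (P *v ?d)"
      using matrix_vector_mult_scaleR[of P "-1" ?d] by simp
    ultimately show ?thesis
      by (simp only: sq_norm_wrt_add[OF P_symmetric]) simp
  qed
  ultimately show ?thesis
    by (simp add: potential_def distrib_left left_diff_distrib right_diff_distrib)
qed

section \<open>Monotonicity of the potential centred at a KKT point\<close>

context
  fixes y \<mu>
  assumes kkt: "KKT F A b y \<mu>"
begin

text \<open>This is the subgradient inequality at \<open>y\<close> with \<open>A *v y = b\<close>: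
  the Lagrangian with multiplier \<open>\<mu>\<close> is minimal at \<open>y\<close>.\<close>

lemma KKT_lower_bound:
  assumes "F z = ereal s" "F y = ereal t"
  shows "\<mu> \<bullet> (A *v z - b) \<le> s - t"
  using kkt assms unfolding KKT_iff
  by (auto dest!: spec[of _ z] simp: matrix_vector_mult_diff_distrib algebra_simps)

text \<open>At a KKT centre the Lagrangian gap in \<open>potential_decrease\<close> is nonnegative,
  so only the two squares remain. Their coefficients are at least \<open>m / 2\<close>, from
  definiteness, and \<open>\<beta> - \<gamma> / 2\<close>, from the bound on
  \<open>\<gamma>\<close>.\<close>

lemma KKT_decrease:
  obtains m where "0 < m"
    "\<And>k. 1 \<le> k \<Longrightarrow> m * ((norm (residual (Suc k)))\<^sup>2 + (norm (x (Suc k) - x k))\<^sup>2)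
      \<le> potential y \<mu> k - potential y \<mu> (Suc k)"
proof -
  obtain m where m: "0 < m" "\<And>v. m * (norm v)\<^sup>2 + L * (norm v)\<^sup>2 \<le> sq_norm_wrt P v"
    using coercive by metis
  obtain s where s: "F y = ereal s" "A *v y = b"
    using kkt by (cases "F y") (auto simp: KKT_iff)
  have "min (m / 2) (\<beta> - \<gamma> / 2) * ((norm (residual (Suc k)))\<^sup>2 + (norm (x (Suc k) - x k))\<^sup>2)
      \<le> potential y \<mu> k - potential y \<mu> (Suc k)" if k: "1 \<le> k" for k
  proof -
    have "min (m / 2) (\<beta> - \<gamma> / 2) * (norm (residual (Suc k)))\<^sup>2
        \<le> (\<beta> - \<gamma> / 2) * (norm (residual (Suc k)))\<^sup>2"
      by (intro mult_right_mono) auto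
    moreover have "min (m / 2) (\<beta> - \<gamma> / 2) * (norm (x (Suc k) - x k))\<^sup>2
        \<le> m / 2 * (norm (x (Suc k) - x k))\<^sup>2"
      by (intro mult_right_mono min.cobounded1) simp
    moreover have "\<mu> \<bullet> residual (Suc k) \<le> val (Suc k) - s"
      using KKT_lower_bound[OF F_val[OF k] s(1)] by (simp add: residual_def)
    ultimately show ?thesis
      using potential_decrease[OF k s(2) s(1), of \<mu>] m(2)[of "x (Suc k) - x k"]
      unfolding distrib_left right_diff_distrib by linarith
  qed
  moreover have "0 < min (m / 2) (\<beta> - \<gamma> / 2)"
    using m(1) \<gamma>_less by simp
  ultimately show thesis
    using that by blast
qed

text \<open>The shift by \<open>Suc\<close> skips index 0, where the sequences are
  unconstrained.\<close>

lemma potential_antimono: "decseq (\<lambda>n. potential y \<mu> (Suc n))"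
proof (rule decseq_SucI)
  fix n
  obtain m where m: "0 < m" "m * ((norm (residual (Suc (Suc n))))\<^sup>2 + (norm (x (Suc (Suc n)) - x (Suc n)))\<^sup>2)
      \<le> potential y \<mu> (Suc n) - potential y \<mu> (Suc (Suc n))"
    using KKT_decrease by (metis Suc_eq_plus1_left le_add1)
  moreover have "0 \<le> m * ((norm (residual (Suc (Suc n))))\<^sup>2 + (norm (x (Suc (Suc n)) - x (Suc n)))\<^sup>2)"
    using m(1) by simp
  ultimately show "potential y \<mu> (Suc (Suc n)) \<le> potential y \<mu> (Suc n)"
    by linarith
qed

lemma residual_and_increment_tendsto_0:
  "(\<lambda>n. residual (Suc (Suc n))) \<longlonglongrightarrow> 0" "(\<lambda>n. x (Suc (Suc n)) - x (Suc n)) \<longlonglongrightarrow> 0"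
proof -
  obtain m where m: "0 < m"
    "\<And>k. 1 \<le> k \<Longrightarrow> m * ((norm (residual (Suc k)))\<^sup>2 + (norm (x (Suc k) - x k))\<^sup>2)
      \<le> potential y \<mu> k - potential y \<mu> (Suc k)"
    using KKT_decrease by blast
  obtain p where p: "(\<lambda>n. potential y \<mu> (Suc n)) \<longlonglongrightarrow> p"
    using decseq_convergent[OF potential_antimono, of 0] potential_nonneg by metis
  \<comment> \<open>\<open>e\<close> dominates both squared norms and tends to 0, as consecutive
    terms of the convergent potential have the same limit \<open>p\<close>.\<close>
  define e where "e n = (potential y \<mu> (Suc n) - potential y \<mu> (Suc (Suc n))) / m" for n
  have "e \<longlonglongrightarrow> (p - p) / m"
    unfolding e_def using m(1) by (intro tendsto_intros p LIMSEQ_Suc[OF p]) simp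
  then have e: "(\<lambda>n. sqrt (e n)) \<longlonglongrightarrow> 0"
    using tendsto_real_sqrt[of e 0] by simp
  have le: "(norm (residual (Suc (Suc n))))\<^sup>2 + (norm (x (Suc (Suc n)) - x (Suc n)))\<^sup>2 \<le> e n" for n
    using m(2)[of "Suc n"] m(1) by (simp add: e_def pos_le_divide_eq mult.commute)
  have "norm (residual (Suc (Suc n))) \<le> sqrt (e n)" for n
    using le[of n] by (intro real_le_rsqrt) (smt (verit) zero_le_power2)
  then show "(\<lambda>n. residual (Suc (Suc n))) \<longlonglongrightarrow> 0"
    by (intro Lim_null_comparison[OF _ e] always_eventually) blast
  have "norm (x (Suc (Suc n)) - x (Suc n)) \<le> sqrt (e n)" for n
    using le[of n] by (intro real_le_rsqrt) (smt (verit) zero_le_power2)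
  then show "(\<lambda>n. x (Suc (Suc n)) - x (Suc n)) \<longlonglongrightarrow> 0"
    by (intro Lim_null_comparison[OF _ e] always_eventually) blast
qed

end

section \<open>Boundedness and convergence of the iterates\<close>

text \<open>The constant is independent of the centre and the index, so it serves both for
  boundedness around a given KKT point and for convergence to the cluster point.\<close>

lemma potential_controls_distance:
  obtains c where "0 < c"
    "\<And>y \<mu> k. (norm (x k - y))\<^sup>2 \<le> c * potential y \<mu> k" "\<And>y \<mu> k. (norm (l k - \<mu>))\<^sup>2 \<le> c * potential y \<mu> k"
proof -
  obtain m where m: "0 < m" "\<And>v. m * (norm v)\<^sup>2 \<le> sq_norm_wrt P v"
    using coercive by metis
  define c where "c = max (2 / m) (2 * \<gamma>)"
  have c: "2 / m \<le> c" "2 * \<gamma> \<le> c" "0 < c"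
    using m(1) \<gamma>_pos by (auto simp: c_def)
  have "m / 2 * (norm (x k - y))\<^sup>2 \<le> potential y \<mu> k" for y \<mu> k
    using m(2)[of "x k - y"] \<gamma>_pos by (simp add: potential_def add_increasing2)
  then have "(norm (x k - y))\<^sup>2 \<le> 2 / m * potential y \<mu> k" for y \<mu> k
    using m(1) by (simp add: field_simps)
  then have "(norm (x k - y))\<^sup>2 \<le> c * potential y \<mu> k" for y \<mu> k
    using mult_right_mono[OF c(1) potential_nonneg] order_trans by blast
  moreover
  have "0 \<le> sq_norm_wrt P v" for v
    using m by (metis mult_nonneg_nonneg order_trans less_imp_le zero_le_power2)
  then have "(norm (l k - \<mu>))\<^sup>2 \<le> 2 * \<gamma> * potential y \<mu> k" for y \<mu> k
    using \<gamma>_pos by (simp add: potential_def field_simps)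
  then have "(norm (l k - \<mu>))\<^sup>2 \<le> c * potential y \<mu> k" for y \<mu> k
    using mult_right_mono[OF c(2) potential_nonneg] order_trans by blast
  ultimately show thesis
    using that c(3) by blast
qed

lemma bounded_iterates:
  assumes "KKT F A b y \<mu>"
  shows "bounded ((\<lambda>k. (x k, l k)) ` {1..})"
proof -
  obtain c where c: "0 < c"
    "\<And>y \<mu> k. (norm (x k - y))\<^sup>2 \<le> c * potential y \<mu> k" "\<And>y \<mu> k. (norm (l k - \<mu>))\<^sup>2 \<le> c * potential y \<mu> k"
    using potential_controls_distance by blast
  define R where "R = sqrt (c * potential y \<mu> 1)"
  have pot: "c * potential y \<mu> k \<le> c * potential y \<mu> 1" if "1 \<le> k" for k
    using decseqD[OF potential_antimono[OF assms], of 0 "k - 1"] that c(1) by simp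
  have "x k \<in> cball y R" "l k \<in> cball \<mu> R" if "1 \<le> k" for k
    using order_trans[OF c(2) pot[OF that]] order_trans[OF c(3) pot[OF that]]
    by (auto simp: R_def dist_norm norm_minus_commute intro!: real_le_rsqrt)
  then have "(\<lambda>k. (x k, l k)) ` {1..} \<subseteq> cball y R \<times> cball \<mu> R"
    by auto
  then show ?thesis
    by (rule bounded_subset[OF bounded_Times[OF bounded_cball bounded_cball]])
qed

text \<open>Residuals and increments vanish, so the bound in \<open>step\<close> converges to
  \<open>s + linf \<bullet> (A *v (xinf - z))\<close>, and closedness of the epigraph preserves the
  inequality. Rearranged, it says that \<open>linf\<close> satisfies the subgradient inequality at
  \<open>xinf\<close>.\<close>

lemma cluster_point_KKT:
  assumes kkt: "KKT F A b y \<mu>" and "strict_mono \<sigma>"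
    and lim: "(\<lambda>n. x (Suc (\<sigma> n))) \<longlonglongrightarrow> xinf" "(\<lambda>n. l (Suc (\<sigma> n))) \<longlonglongrightarrow> linf"
  shows "KKT F A b xinf linf"
proof -
  define K where "K n = Suc (\<sigma> n)" for n
  have K: "1 \<le> K n" for n
    by (simp add: K_def)
  have r: "(\<lambda>n. A *v x (Suc (K n)) - b) \<longlonglongrightarrow> 0" and d: "(\<lambda>n. x (Suc (K n)) - x (K n)) \<longlonglongrightarrow> 0"
    using LIMSEQ_subseq_LIMSEQ[OF residual_and_increment_tendsto_0(1)[OF kkt] assms(2)]
      LIMSEQ_subseq_LIMSEQ[OF residual_and_increment_tendsto_0(2)[OF kkt] assms(2)]
    by (simp_all add: o_def K_def residual_def)
  have x0: "(\<lambda>n. x (K n)) \<longlonglongrightarrow> xinf" and l0: "(\<lambda>n. l (K n)) \<longlonglongrightarrow> linf"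
    using lim by (simp_all add: K_def)
  \<comment> \<open>The hypothesis gives the limit of \<open>x (K n)\<close> only; the vanishing
    increment transfers it to the next iterate.\<close>
  have x1: "(\<lambda>n. x (Suc (K n))) \<longlonglongrightarrow> xinf"
    using tendsto_add[OF d x0] by simp
  have mv: "(\<lambda>n. M *v w n) \<longlonglongrightarrow> M *v w'" if "w \<longlonglongrightarrow> w'" for M :: "real^'n^'k" and w w'
    using that by (rule bounded_linear.tendsto[OF matrix_vector_mul_bounded_linear])
  have "(\<lambda>n. A *v x (Suc (K n)) - b) \<longlonglongrightarrow> A *v xinf - b"
    by (intro tendsto_intros mv x1)
  with r have feasible: "A *v xinf = b"
    using LIMSEQ_unique by fastforce
  have upper: "F xinf \<le> ereal (s + linf \<bullet> (A *v (xinf - z)))" if z: "F z \<le> ereal s" for z s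
  proof -
    define q where "q n = s + (l (K n) - \<beta> *\<^sub>R (A *v x (Suc (K n)) - b)) \<bullet> (A *v (x (Suc (K n)) - z))
      - (P *v (x (Suc (K n)) - x (K n))) \<bullet> (x (Suc (K n)) - z)
      + L / 2 * (norm (x (Suc (K n)) - x (K n)))\<^sup>2" for n
    have "q \<longlonglongrightarrow> s + (linf - \<beta> *\<^sub>R 0) \<bullet> (A *v (xinf - z)) - (P *v 0) \<bullet> (xinf - z)
        + L / 2 * (norm (0 :: real^'n))\<^sup>2"
      unfolding q_def by (intro tendsto_intros mv l0 x1 r d)
    then have lim: "(\<lambda>n. (x (Suc (K n)), q n)) \<longlonglongrightarrow> (xinf, s + linf \<bullet> (A *v (xinf - z)))"
      using x1 by (intro tendsto_Pair) simp_all
    have mem: "(x (Suc (K n)), q n) \<in> ereal_epigraph F" for n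
      using step[OF K z] by (simp add: ereal_epigraph_def q_def)
    have "(xinf, s + linf \<bullet> (A *v (xinf - z))) \<in> ereal_epigraph F"
      by (rule closed_sequentially[OF F_closed[unfolded closed_fun_def] mem lim])
    then show ?thesis
      by (simp add: ereal_epigraph_def)
  qed
  \<comment> \<open>Tested at the given KKT point, where \<open>F\<close> is finite, the limiting
    bound makes \<open>F xinf\<close> finite.\<close>
  have "F xinf \<noteq> \<infinity>"
    using upper[of y "real_of_ereal (F y)"] kkt by (auto simp: KKT_iff ereal_real)
  then obtain s where s: "F xinf = ereal s"
    using F_not_MInf[of xinf] by (cases "F xinf") auto
  have "F xinf + ereal (linf \<bullet> (A *v (z - xinf))) \<le> F z" for z
  proof (cases "F z")
    case (real t)
    then show ?thesis
      using upper[of z t] s by (simp add: matrix_vector_mult_diff_distrib inner_diff_right)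
  qed (use F_not_MInf in auto)
  with s feasible show ?thesis
    by (simp add: KKT_iff)
qed

text \<open>A Fejer-type argument: the cluster point is itself a KKT point, so the potential centred
  there is monotone and has a limit. Along the subsequence that limit is 0, hence the whole sequence
  approaches the cluster point.\<close>

lemma iterates_converge:
  assumes kkt: "KKT F A b y \<mu>"
  obtains xinf linf where "(\<lambda>k. (x k, l k)) \<longlonglongrightarrow> (xinf, linf)" "KKT F A b xinf linf"
proof -
  have "bounded (range (\<lambda>n. (x (Suc n), l (Suc n))))"
    by (rule bounded_subset[OF bounded_iterates[OF kkt]]) auto
  from bounded_imp_convergent_subsequence[OF this] obtain q \<sigma> where \<sigma>: "strict_mono \<sigma>"
    and q: "((\<lambda>n. (x (Suc n), l (Suc n))) \<circ> \<sigma>) \<longlonglongrightarrow> q"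
    by blast
  obtain xinf linf where "q = (xinf, linf)"
    by (rule prod.exhaust)
  with q have lim: "((\<lambda>n. (x (Suc n), l (Suc n))) \<circ> \<sigma>) \<longlonglongrightarrow> (xinf, linf)"
    by simp
  have xl: "(\<lambda>n. x (Suc (\<sigma> n))) \<longlonglongrightarrow> xinf" "(\<lambda>n. l (Suc (\<sigma> n))) \<longlonglongrightarrow> linf"
    using tendsto_fst[OF lim] tendsto_snd[OF lim] by (simp_all add: o_def)
  have kkt': "KKT F A b xinf linf"
    by (rule cluster_point_KKT[OF kkt \<sigma> xl])
  obtain p where p: "(\<lambda>n. potential xinf linf (Suc n)) \<longlonglongrightarrow> p"
    using decseq_convergent[OF potential_antimono[OF kkt'], of 0] potential_nonneg by metis
  have sub: "(\<lambda>n. potential xinf linf (Suc (\<sigma> n))) \<longlonglongrightarrow> p"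
    using LIMSEQ_subseq_LIMSEQ[OF p \<sigma>] by (simp add: o_def)
  have "(\<lambda>n. potential xinf linf (Suc (\<sigma> n))) \<longlonglongrightarrow>
      1 / 2 * ((xinf - xinf) \<bullet> (P *v (xinf - xinf))) + (norm (linf - linf))\<^sup>2 / (2 * \<gamma>)"
    unfolding potential_def sq_norm_wrt_def using \<gamma>_pos
    by (intro tendsto_intros xl bounded_linear.tendsto[OF matrix_vector_mul_bounded_linear]) simp
  then have "p = 0"
    using LIMSEQ_unique[OF sub] by simp
  with p have p0: "(\<lambda>n. potential xinf linf (Suc n)) \<longlonglongrightarrow> 0"
    by simp
  obtain c where c: "0 < c" "\<And>y \<mu> k. (norm (x k - y))\<^sup>2 \<le> c * potential y \<mu> k"
    "\<And>y \<mu> k. (norm (l k - \<mu>))\<^sup>2 \<le> c * potential y \<mu> k"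
    using potential_controls_distance by blast
  have q0: "(\<lambda>n. sqrt (c * potential xinf linf (Suc n))) \<longlonglongrightarrow> 0"
    using tendsto_real_sqrt[OF tendsto_mult_left[OF p0, of c]] by simp
  have "(\<lambda>n. x (Suc n) - xinf) \<longlonglongrightarrow> 0" "(\<lambda>n. l (Suc n) - linf) \<longlonglongrightarrow> 0"
    by (intro Lim_null_comparison[OF _ q0] always_eventually allI real_le_rsqrt c)+
  then have "(\<lambda>n. (x (Suc n), l (Suc n))) \<longlonglongrightarrow> (xinf, linf)"
    by (intro tendsto_Pair) (simp_all add: LIM_zero_iff)
  then show thesis
    using that kkt' LIMSEQ_imp_Suc[of "\<lambda>k. (x k, l k)"] by blast
qed

section \<open>Ergodic convergence rates\<close>

context
  fixes t :: nat
  assumes t: "1 \<le> t"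
begin

definition average :: "real^'n" where
  "average = (1 / real t) *\<^sub>R (\<Sum>k=1..t. x (k + 1))"

text \<open>Summing \<open>potential_decrease\<close> telescopes, and \<open>l 1 = 0\<close> reduces
  the initial multiplier term to the square of \<open>norm \<mu>\<close>. Leaving
  \<open>\<mu>\<close> free allows it to depend on the averaged residual later.\<close>

lemma ergodic_bound:
  assumes y: "A *v y = b" "F y = ereal s"
  shows "F average \<le> ereal (s + \<mu> \<bullet> (A *v average - b)
    + 1 / real t * (1 / 2 * sq_norm_wrt P (x 1 - y) + (norm \<mu>)\<^sup>2 / (2 * \<gamma>)))"
proof -
  define v where "v = (1 / real t) * (\<Sum>k=1..t. val (Suc k))"
  \<comment> \<open>Jensen's inequality, read as a convex combination of points of the
    epigraph.\<close>
  have "(\<Sum>k=1..t. (1 / real t) *\<^sub>R (x (Suc k), val (Suc k))) \<in> ereal_epigraph F"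
    using F_val t by (intro convex_sum F_convex[unfolded convex_fun_def])
      (auto simp: ereal_epigraph_def)
  moreover have "(\<Sum>k=1..t. (1 / real t) *\<^sub>R (x (Suc k), val (Suc k))) = (average, v)"
    by (simp add: average_def v_def prod_eq_iff fst_sum snd_sum scaleR_sum_right sum_divide_distrib)
  ultimately have F: "F average \<le> ereal v"
    by (simp add: ereal_epigraph_def)
  have res: "(\<Sum>k=1..t. residual (Suc k)) = real t *\<^sub>R (A *v average - b)"
  proof -
    have "real t *\<^sub>R (A *v average) = A *v (\<Sum>k=1..t. x (Suc k))"
      using t by (simp add: average_def matrix_vector_mult_scaleR)
    also have "\<dots> = (\<Sum>k=1..t. A *v x (Suc k))"
      by (simp add: linear_sum matrix_vector_mul_linear)
    finally show ?thesis
      by (simp add: residual_def sum_subtractf scaleR_diff_right sum_constant_scaleR del: sum_constant)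
  qed
  have "(\<Sum>k=1..t. val (Suc k) - s - \<mu> \<bullet> residual (Suc k))
      \<le> (\<Sum>k=1..t. potential y \<mu> k - potential y \<mu> (Suc k))"
  proof (rule sum_mono)
    fix k assume "k \<in> {1..t}"
    obtain m where m: "0 < m" "\<And>v. m * (norm v)\<^sup>2 + L * (norm v)\<^sup>2 \<le> sq_norm_wrt P v"
      using coercive by metis
    have "0 \<le> m * (norm (x (Suc k) - x k))\<^sup>2" "0 \<le> (\<beta> - \<gamma> / 2) * (norm (residual (Suc k)))\<^sup>2"
      using m(1) \<gamma>_less by simp_all
    then show "val (Suc k) - s - \<mu> \<bullet> residual (Suc k) \<le> potential y \<mu> k - potential y \<mu> (Suc k)"
      using potential_decrease[OF _ y, of k \<mu>] m(2)[of "x (Suc k) - x k"] \<open>k \<in> {1..t}\<close>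
      unfolding right_diff_distrib atLeastAtMost_iff by linarith
  qed
  also have "\<dots> = potential y \<mu> 1 - potential y \<mu> (Suc t)"
    using t sum_Suc_diff[of 1 t "\<lambda>k. - potential y \<mu> k"] by simp
  also have "\<dots> \<le> potential y \<mu> 1"
    using potential_nonneg by simp
  also have "\<dots> = 1 / 2 * sq_norm_wrt P (x 1 - y) + (norm \<mu>)\<^sup>2 / (2 * \<gamma>)"
    using multiplier_1 by (simp add: potential_def)
  finally have *: "(\<Sum>k=1..t. val (Suc k)) - real t * s - real t * (\<mu> \<bullet> (A *v average - b))
      \<le> 1 / 2 * sq_norm_wrt P (x 1 - y) + (norm \<mu>)\<^sup>2 / (2 * \<gamma>)" (is "_ \<le> ?C")
    by (simp add: sum_subtractf inner_sum_right[symmetric] res del: One_nat_def)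
  have "v * real t = (\<Sum>k=1..t. val (Suc k))"
    using t by (simp add: v_def)
  then have "real t * v \<le> real t * (s + \<mu> \<bullet> (A *v average - b) + 1 / real t * ?C)"
    using * t by (simp add: distrib_left mult.commute)
  then have "v \<le> s + \<mu> \<bullet> (A *v average - b) + 1 / real t * ?C"
    by (rule mult_left_le_imp_le) (use t in simp)
  with F show ?thesis
    by (meson ereal_less_eq(3) order_trans)
qed

text \<open>A multiplier of norm \<open>2 * norm \<mu>\<close> opposite to the residual
  \<open>r\<close> subtracts \<open>2 * norm \<mu> * norm r\<close> from the upper bound, whereas
  the KKT lower bound loses at most \<open>norm \<mu> * norm r\<close>. The difference bounds the
  infeasibility, and the objective gap is bounded on both sides.\<close>

lemma ergodic_rate:
  assumes kkt: "KKT F A b y \<mu>"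
  defines "B \<equiv> 1 / 2 * sq_norm_wrt P (x 1 - y) + 2 * (norm \<mu>)\<^sup>2 / \<gamma>"
  shows "\<bar>F average - F y\<bar> \<le> ereal (1 / real t * B)"
    and "\<mu> \<noteq> 0 \<longrightarrow> norm (A *v average - b) \<le> 1 / (real t * norm \<mu>) * B"
proof -
  obtain s where s: "F y = ereal s" and y: "A *v y = b"
    using kkt by (cases "F y") (auto simp: KKT_iff)
  define r where "r = A *v average - b"
  define \<nu> where "\<nu> = - (2 * norm \<mu>) *\<^sub>R sgn r"
  have "\<nu> \<bullet> r = - (2 * norm \<mu>) * norm r"
    by (cases "r = 0") (simp_all add: \<nu>_def sgn_div_norm power2_norm_eq_inner[symmetric] power2_eq_square)
  \<comment> \<open>Equality holds unless \<open>r = 0\<close>, where \<open>sgn r = 0\<close> makes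
    \<open>\<nu>\<close> vanish.\<close>
  moreover have "(norm \<nu>)\<^sup>2 / (2 * \<gamma>) \<le> 2 * (norm \<mu>)\<^sup>2 / \<gamma>"
    using \<gamma>_pos by (auto simp: \<nu>_def norm_sgn power_mult_distrib)
  then have "1 / real t * (1 / 2 * sq_norm_wrt P (x 1 - y) + (norm \<nu>)\<^sup>2 / (2 * \<gamma>)) \<le> 1 / real t * B"
    unfolding B_def by (intro mult_left_mono) auto
  ultimately have "F average \<le> ereal (s - 2 * (norm \<mu> * norm r) + 1 / real t * B)"
    using ergodic_bound[OF y s, of \<nu>] by (auto simp: r_def elim!: order_trans)
  moreover from this obtain v where v: "F average = ereal v"
    using F_not_MInf[of average] by (cases "F average") auto
  ultimately have upper: "v - s + 2 * (norm \<mu> * norm r) \<le> 1 / real t * B"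
    by simp
  have "\<bar>\<mu> \<bullet> r\<bar> \<le> norm \<mu> * norm r"
    by (rule Cauchy_Schwarz_ineq2)
  then have lower: "- (norm \<mu> * norm r) \<le> v - s"
    using KKT_lower_bound[OF kkt v s] by (simp add: r_def)
  have "0 \<le> norm \<mu> * norm r"
    by simp
  with upper lower have gap: "\<bar>v - s\<bar> \<le> 1 / real t * B" and infeas: "norm \<mu> * norm r \<le> 1 / real t * B"
    by linarith+
  from gap show "\<bar>F average - F y\<bar> \<le> ereal (1 / real t * B)"
    by (simp add: v s)
  have "norm r \<le> 1 / real t * B / norm \<mu>" if "\<mu> \<noteq> 0"
    using infeas that by (subst pos_le_divide_eq) (simp_all add: mult.commute)
  then show "\<mu> \<noteq> 0 \<longrightarrow> norm (A *v average - b) \<le> 1 / (real t * norm \<mu>) * B"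
    by (simp add: r_def)
qed

end

end

section \<open>The method with constant parameters as an instance of the abstract iteration\<close>

theorem theorem2p5:
  fixes f :: "real^'n \<Rightarrow> real" and g :: "real^'n \<Rightarrow> ereal"
    and A :: "real^'n^'m" and b :: "real^'m"
    and L \<beta> \<gamma> :: real and \<alpha>s \<beta>s \<gamma>s :: "nat \<Rightarrow> real"
    and P :: "real^'n^'n" and Ps :: "nat \<Rightarrow> real^'n^'n"
    and x xb :: "nat \<Rightarrow> real^'n" and l :: "nat \<Rightarrow> real^'m"
  assumes "convex_on UNIV f" and "\<forall>y. f differentiable (at y)"
    and "proper_fun g" and "closed_fun g" and "convex_fun g"
    and "\<exists>xs ls. KKT (composite f g) A b xs ls"
    and "L-lipschitz_on UNIV (gradient f)"
    and "accelerated_LALM f g A b \<alpha>s \<beta>s \<gamma>s Ps x xb l"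
    and "\<forall>k\<ge>1. \<alpha>s k = 1 \<and> \<beta>s k = \<beta> \<and> \<gamma>s k = \<gamma> \<and> Ps k = P"
    and "\<beta> > 0" and "0 < \<gamma>" and "\<gamma> < 2 * \<beta>"
    and "symmetric_matrix P" and "positive_definite (P - L *\<^sub>R mat 1)"
  shows "(\<forall>k\<ge>1. xb k = x k) \<and>
    bounded ((\<lambda>k. (x k, l k)) ` {1..}) \<and>
    (\<exists>xinf linf. (\<lambda>k. (x k, l k)) \<longlonglongrightarrow> (xinf, linf) \<and> KKT (composite f g) A b xinf linf) \<and>
    (\<forall>xs ls. KKT (composite f g) A b xs ls \<longrightarrow>
      (\<forall>t\<ge>1. let xt = (1 / real t) *\<^sub>R (\<Sum>k=1..t. x (k + 1));
                 B = 1 / 2 * sq_norm_wrt P (x 1 - xs) + 2 * (norm ls)\<^sup>2 / \<gamma>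
        in \<bar>composite f g xt - composite f g xs\<bar> \<le> ereal (1 / real t * B) \<and>
           (ls \<noteq> 0 \<longrightarrow> norm (A *v xt - b) \<le> 1 / (real t * norm ls) * B)))"
proof -
  have params: "\<alpha>s k = 1" "\<beta>s k = \<beta>" "\<gamma>s k = \<gamma>" "Ps k = P" if "1 \<le> k" for k
    using assms(9) that by auto
  have xb: "xb k = x k" if "1 \<le> k" for k
  proof (cases "k = 1")
    case False
    with that obtain j where "k = j + 1" "1 \<le> j"
      by (cases k) auto
    then show ?thesis
      using assms(8) params[of j] by (simp add: accelerated_LALM_def Let_def)
  qed (use assms(8) in \<open>simp add: accelerated_LALM_def\<close>)
  \<comment> \<open>With unit weights the extrapolated point is \<open>x k\<close>, so the gradient
    in the subproblem is taken at the current iterate.\<close>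
  have amin: "is_arg_min
      (\<lambda>y. ereal ((gradient f (x k) - transpose A *v l k) \<bullet> y) + g y
        + ereal (\<beta> / 2 * (norm (A *v y - b))\<^sup>2) + ereal (1 / 2 * sq_norm_wrt P (y - x k)))
      (\<lambda>_. True) (x (Suc k))" if "1 \<le> k" for k
    using assms(8) that
    by (simp add: accelerated_LALM_def Let_def params xb Suc_eq_plus1
        del: transpose_matrix_vector One_nat_def add_Suc_right)
  have grad: "GDERIV f z :> gradient f z" for z
    using assms(2) by (simp add: GDERIV_gradient)
  interpret linearized_AL_iteration "composite f g" A b P L \<beta> \<gamma> x l
  proof
    show "composite f g y \<noteq> -\<infinity>" for y
      using assms(3) by (auto simp: composite_def proper_fun_def)
    have "continuous_on UNIV f"
      using assms(2) by (meson continuous_at_imp_continuous_on differentiable_imp_continuous_within)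
    then show "closed_fun (composite f g)"
      using assms(4) by (rule closed_fun_composite)
    show "convex_fun (composite f g)"
      using assms(1,5) by (rule convex_fun_composite)
    show "0 \<le> L"
      using assms(7) by (rule lipschitz_on_nonneg)
    show "composite f g (x (Suc k)) \<noteq> \<infinity>" if k: "1 \<le> k" for k
    proof -
      obtain gz where "g (x (Suc k)) = ereal gz"
        using prox_finite[OF assms(3) amin[OF k]] .
      then show ?thesis
        by (simp add: composite_def)
    qed
    show "l (Suc k) = l k - \<gamma> *\<^sub>R (A *v x (Suc k) - b)" if "1 \<le> k" for k
      using assms(8) params[OF that] that by (simp add: accelerated_LALM_def Let_def)
    show "l 1 = 0"
      using assms(8) by (simp add: accelerated_LALM_def)
    fix k :: nat and y s assume k: "1 \<le> k" and "composite f g y \<le> ereal s"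
    then have y: "g y \<le> ereal (s - f y)"
      by (cases "g y") (auto simp: composite_def)
    obtain gz where gz: "g (x (Suc k)) = ereal gz"
      using prox_finite[OF assms(3) amin[OF k]] .
    note prox = prox_inequality[OF assms(3,5,13) amin[OF k] gz y]
    note tangent = convex_above_gradient[OF assms(1) grad, of "x k" y]
    note descent = lipschitz_gradient_upper_bound[OF grad assms(7), of "x (Suc k)" "x k"]
    \<comment> \<open>In the sum of the three inequalities the terms with
      \<open>gradient f (x k)\<close> cancel, since their directions \<open>y - x (Suc k)\<close>,
      \<open>x (Suc k) - x k\<close> and \<open>x k - y\<close> add up to 0.\<close>
    have "f (x (Suc k)) + gz
      \<le> s + (l k - \<beta> *\<^sub>R (A *v x (Suc k) - b)) \<bullet> (A *v (x (Suc k) - y))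
        - (P *v (x (Suc k) - x k)) \<bullet> (x (Suc k) - y) + L / 2 * (norm (x (Suc k) - x k))\<^sup>2"
      using prox tangent descent
      by (simp add: inner_diff dot_lmul_matrix matrix_vector_mult_diff_distrib algebra_simps)
    then show "composite f g (x (Suc k))
      \<le> ereal (s + (l k - \<beta> *\<^sub>R (A *v x (Suc k) - b)) \<bullet> (A *v (x (Suc k) - y))
        - (P *v (x (Suc k) - x k)) \<bullet> (x (Suc k) - y) + L / 2 * (norm (x (Suc k) - x k))\<^sup>2)"
      by (simp add: composite_def gz)
  qed (use assms in auto)
  obtain xs ls where kkt: "KKT (composite f g) A b xs ls"
    using assms(6) by blast
  have rate: "let xt = (1 / real t) *\<^sub>R (\<Sum>k=1..t. x (k + 1));
        B = 1 / 2 * sq_norm_wrt P (x 1 - xs) + 2 * (norm ls)\<^sup>2 / \<gamma>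
      in \<bar>composite f g xt - composite f g xs\<bar> \<le> ereal (1 / real t * B) \<and>
         (ls \<noteq> 0 \<longrightarrow> norm (A *v xt - b) \<le> 1 / (real t * norm ls) * B)"
    if "KKT (composite f g) A b xs ls" "1 \<le> t" for xs ls t
    \<comment> \<open>\<open>average\<close> was introduced under \<open>1 \<le> t\<close>, so that
      premise is discharged before its equation is folded.\<close>
    unfolding Let_def average_def[OF that(2), symmetric]
    using ergodic_rate[OF that(2,1)] by blast
  obtain xinf linf where "(\<lambda>k. (x k, l k)) \<longlonglongrightarrow> (xinf, linf)"
    "KKT (composite f g) A b xinf linf"
    by (rule iterates_converge[OF kkt])
  with xb bounded_iterates[OF kkt] rate show ?thesis
    by (intro conjI exI allI impI)
qed

end
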